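(* Let $(X,\mathcal{C})$ be a separable convexity space with bounded Radon number, and suppose that the system of halfspaces of $(X,\mathcal{C})$ has dual VC-dimension $d$. Then the fractional Helly number for $\mathcal{C}$ is at most $d+1$; that is, there exists a function $\beta:(0,1)\to(0,1)$ such that every finite family $F\subset\mathcal{C}$ containing at least $\alpha\binom{|F|}{d+1}$ intersecting $(d+1)$-tuples contains an intersecting subfamily of size at least $\beta(\alpha)\,|F|$.
   Context: A convexity space $(X,\mathcal{C})$ is a non-empty set $X$ with $\mathcal{C}\subset 2^X$ such that: $\emptyset, X\in\mathcal{C}$; $\mathcal{C}$ is closed under intersections of non-empty subfamilies; and $\mathcal{C}$ is closed under unions of non-empty subfamilies totally ordered by inclusion. Members of $\mathcal{C}$ are convex sets; $\mathrm{conv}(Y)$ is the intersection of all convex sets containing $Y$. The Radon number is the smallest $n$ (if it exists) such that every $Y\subset X$ with $|Y|=n$ has a partition $Y=A\cup B$ with $\mathrm{conv}(A)\cap\mathrm{conv}(B)\neq\emptyset$; "bounded Radon number" means it exists. A halfspace is $\gamma\in\mathcal{C}$ with $\bar\gamma=X\setminus\gamma\in\mathcal{C}$ (including $\emptyset$ and $X$). The space is separable if for every $S\in\mathcal{C}$ and $x\in X\setminus S$ there is a halfspace $\gamma$ with $S\subset\gamma$ and $x\in\bar\gamma$. For a set system $\mathcal{F}$ on $X$, the dual VC-dimension is the largest $k$ such that some $k$ members of $\mathcal{F}$ have a complete Venn diagram (all $2^k$ regions of the Venn diagram within $X$ are non-empty). A family of sets is intersecting if the intersection of all its members is non-empty.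 A set system $\mathcal{C}$ has the fractional Helly property for $k$-tuples if there is $\beta:(0,1)\to(0,1)$ such that every finite $F\subset\mathcal{C}$ with at least $\alpha\binom{|F|}{k}$ intersecting $k$-tuples contains an intersecting subfamily of size at least $\beta(\alpha)|F|$; the fractional Helly number is the smallest such $k$.
   Formalization: The claim is proved for families F with |F| ≥ d+1; for smaller F the tuple condition is vacuous (the binomial is 0), and the literal statement fails for F = {∅} when d ≥ 1. *)

theory Defs
  imports Complex_Main
begin

definition convexity_space :: "'a set \<Rightarrow> 'a set set \<Rightarrow> bool" where
  "convexity_space X C \<longleftrightarrow>
     X \<noteq> {} \<and> C \<subseteq> Pow X \<and> {} \<in> C \<and> X \<in> C \<and>
     (\<forall>F. F \<subseteq> C \<and> F \<noteq> {} \<longrightarrow> \<Inter>F \<in> C) \<and>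
     (\<forall>F. F \<subseteq> C \<and> F \<noteq> {} \<and> (\<forall>A\<in>F. \<forall>B\<in>F. A \<subseteq> B \<or> B \<subseteq> A)
          \<longrightarrow> \<Union>F \<in> C)"

definition conv :: "'a set set \<Rightarrow> 'a set \<Rightarrow> 'a set" where
  "conv C Y = \<Inter>{S \<in> C. Y \<subseteq> S}"

definition bounded_radon_number :: "'a set \<Rightarrow> 'a set set \<Rightarrow> bool" where
  "bounded_radon_number X C \<longleftrightarrow>
     (\<exists>n::nat. \<forall>Y. Y \<subseteq> X \<and> finite Y \<and> card Y = n \<longrightarrow>
        (\<exists>A B. Y = A \<union> B \<and> A \<inter> B = {} \<and> conv C A \<inter> conv C B \<noteq> {}))"

definition halfspaces :: "'a set \<Rightarrow> 'a set set \<Rightarrow> 'a set set" where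
  "halfspaces X C = {\<gamma> \<in> C. X - \<gamma> \<in> C}"

definition separable :: "'a set \<Rightarrow> 'a set set \<Rightarrow> bool" where
  "separable X C \<longleftrightarrow>
     (\<forall>S \<in> C. \<forall>x \<in> X - S. \<exists>\<gamma> \<in> halfspaces X C. S \<subseteq> \<gamma> \<and> x \<in> X - \<gamma>)"

definition has_complete_venn :: "'a set \<Rightarrow> 'a set set \<Rightarrow> nat \<Rightarrow> bool" where
  "has_complete_venn X H k \<longleftrightarrow>
     (\<exists>S \<subseteq> H. finite S \<and> card S = k \<and>
        (\<forall>T \<subseteq> S. \<exists>x \<in> X. \<forall>\<gamma> \<in> S. x \<in> \<gamma> \<longleftrightarrow> \<gamma> \<in> T))"

definition dual_vc_dim :: "'a set \<Rightarrow> 'a set set \<Rightarrow> nat \<Rightarrow> bool" where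
  "dual_vc_dim X H d \<longleftrightarrow>
     has_complete_venn X H d \<and> (\<forall>k. has_complete_venn X H k \<longrightarrow> k \<le> d)"

definition intersecting :: "'a set set \<Rightarrow> bool" where
  "intersecting G \<longleftrightarrow> \<Inter>G \<noteq> {}"

definition fractional_helly :: "'a set set \<Rightarrow> nat \<Rightarrow> bool" where
  "fractional_helly C k \<longleftrightarrow>
     (\<exists>\<beta>::real \<Rightarrow> real.
        (\<forall>\<alpha>. 0 < \<alpha> \<and> \<alpha> < 1 \<longrightarrow> 0 < \<beta> \<alpha> \<and> \<beta> \<alpha> < 1) \<and>
        (\<forall>\<alpha> F. 0 < \<alpha> \<and> \<alpha> < 1 \<and> finite F \<and> F \<subseteq> C \<and> k \<le> card F \<and>
           real (card {T. T \<subseteq> F \<and> card T = k \<and> intersecting T})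
              \<ge> \<alpha> * real (card F choose k)
           \<longrightarrow> (\<exists>G \<subseteq> F. intersecting G \<and> real (card G) \<ge> \<beta> \<alpha> * real (card F))))"

end

theory Submission
  imports Defs "HOL-Library.FuncSet"
begin

text \<open>
  Let \<open>D = d + 1\<close>, let \<open>F\<close> contain many intersecting \<open>D\<close>-tuples, and suppose that no point lies in
  \<open>\<beta> |F|\<close> members of \<open>F\<close>. Draw \<open>D\<close> classes of \<open>T\<close> random members of \<open>F\<close> each. By supersaturation,
  with probability bounded below in terms of the density, every rainbow tuple \<open>x\<close> of the sample
  has a common point \<open>pt x\<close>.

  The Radon number bounds the Helly number by some \<open>h\<close>. Call a set of grid points small if it
  contains no large subgrid; by the pigeonhole principle \<open>h\<close> small sets do not cover a huge grid. So
  the hulls of the points \<open>pt x\<close> with \<open>x j = s\<close>, a small set of them removed, have a common point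
  \<open>z\<close>, the centre. It does not depend on the \<open>r\<close>-th member of class \<open>j\<close> for \<open>r \<noteq> s\<close>, which therefore
  contains \<open>z\<close> with probability at most \<open>\<beta>\<close>. By a union bound, some sample has all rainbow tuples
  intersecting while none of these incidences occurs.

  For such a sample, separability gives a halfspace that contains the \<open>r\<close>-th member of class \<open>j\<close> but
  not \<open>z\<close>, and by the choice of \<open>z\<close> it misses \<open>pt x\<close> for all \<open>x\<close> with \<open>x j = s\<close> in a large subgrid.
  Passing to subgrids for all pairs \<open>r, s\<close> and all classes \<open>j\<close> leaves one halfspace for each class,
  and these \<open>D\<close> halfspaces have a complete Venn diagram, a contradiction.
\<close>

section \<open>Helly number and centres of grids\<close>

lemma conv_subset: "K \<in> C \<Longrightarrow> Y \<subseteq> K \<Longrightarrow> conv C Y \<subseteq> K"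
  unfolding conv_def by auto

lemma subset_conv: "Y \<subseteq> conv C Y"
  unfolding conv_def by auto

lemma conv_in: "convexity_space X C \<Longrightarrow> Y \<subseteq> X \<Longrightarrow> conv C Y \<in> C"
  unfolding convexity_space_def conv_def by (metis (no_types, lifting) empty_iff mem_Collect_eq subsetI)

locale radon_space =
  fixes X :: "'a set" and C :: "'a set set" and h :: nat
  assumes convexity: "convexity_space X C"
    and radon: "\<And>Y. Y \<subseteq> X \<Longrightarrow> finite Y \<Longrightarrow> card Y = h \<Longrightarrow>
        \<exists>A B. Y = A \<union> B \<and> A \<inter> B = {} \<and> conv C A \<inter> conv C B \<noteq> {}"

text \<open>Radon's classical argument. The witness \<open>x i\<close> lies in every set except
  perhaps \<open>S i\<close>; split \<open>h\<close> of the witnesses into \<open>A\<close> and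
  \<open>B\<close> with meeting hulls. As \<open>x k\<close> belongs to at most one of
  \<open>A\<close> and \<open>B\<close>, the set \<open>S k\<close> includes the other one, and with
  it the common point of the hulls.\<close>

lemma (in radon_space) helly:
  fixes S :: "'i \<Rightarrow> 'a set"
  assumes fin: "finite I"
    and S: "\<And>i. i \<in> I \<Longrightarrow> S i \<in> C"
    and small: "\<And>L. L \<subseteq> I \<Longrightarrow> card L \<le> h \<Longrightarrow> (\<Inter>i\<in>L. S i) \<noteq> {}"
  shows "(\<Inter>i\<in>I. S i) \<noteq> {}"
  using fin S small
proof (induction I rule: finite_psubset_induct)
  case (psubset I)
  show ?case
  proof (cases "card I \<le> h")
    case True
    then show ?thesis using psubset.prems(2)[of I] by auto
  next
    case False
    have "(\<Inter>k\<in>I - {i}. S k) \<noteq> {}" if "i \<in> I" for i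
    proof (rule psubset.IH)
      show "I - {i} \<subset> I" using that by blast
      show "(\<Inter>k\<in>L. S k) \<noteq> {}" if "L \<subseteq> I - {i}" "card L \<le> h" for L
        using psubset.prems(2)[of L] that by blast
    qed (use psubset.prems in auto)
    then have "\<forall>i\<in>I. \<exists>x. x \<in> (\<Inter>k\<in>I - {i}. S k)" by (simp only: ex_in_conv) simp
    from bchoice[OF this] obtain x where "\<forall>i\<in>I. x i \<in> (\<Inter>k\<in>I - {i}. S k)" ..
    then have x: "\<And>i k. i \<in> I \<Longrightarrow> k \<in> I \<Longrightarrow> k \<noteq> i \<Longrightarrow> x i \<in> S k" by auto
    show ?thesis
    proof (cases "inj_on x I")
      case False
      then obtain i j where ij: "i \<in> I" "j \<in> I" "i \<noteq> j" "x i = x j"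
        unfolding inj_on_def by blast
      \<comment> \<open>A repeated witness misses no set: as \<open>x i\<close> it could miss only
        \<open>S i\<close>, as \<open>x j\<close> only \<open>S j\<close>.\<close>
      have "x i \<in> S k" if "k \<in> I" for k
        using x[of i k] x[of j k] ij that by metis
      then show ?thesis by blast
    next
      case inj: True
      obtain I' where I': "I' \<subseteq> I" "card I' = h" "finite I'"
        using False by (meson nat_le_linear obtain_subset_with_card_n)
      have "x ` I' \<subseteq> X"
      proof
        fix y assume "y \<in> x ` I'"
        then obtain i where i: "i \<in> I" "y = x i" using I' by blast
        show "y \<in> X"
        proof (cases "I - {i} = {}")
          case True
          \<comment> \<open>A single index exceeds \<open>h\<close> only for \<open>h = 0\<close>,
            and then the Radon property of the empty set contradicts that \<open>{}\<close> is
            convex.\<close>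
          then have "I = {i}" using i by auto
          then have "h = 0" using False by simp
          moreover have "conv C {} = {}"
            using convexity unfolding convexity_space_def conv_def by auto
          ultimately show ?thesis using radon[of "{}"] by auto
        next
          case False
          then obtain k where "k \<in> I" "k \<noteq> i" by blast
          then show ?thesis using x[of i k] i psubset.prems(1)[of k] convexity unfolding convexity_space_def by auto
        qed
      qed
      moreover have "card (x ` I') = h"
        using inj I' by (metis card_image inj_on_subset)
      ultimately obtain A B where AB: "x ` I' = A \<union> B" "A \<inter> B = {}" "conv C A \<inter> conv C B \<noteq> {}"
        using radon[of "x ` I'"] I'(3) by blast
      then obtain y where y: "y \<in> conv C A" "y \<in> conv C B" by blast
      have "y \<in> S k" if k: "k \<in> I" for k
      proof -
        have sub: "A' \<subseteq> S k" if A': "A' \<subseteq> x ` I'" "x k \<notin> A'" for A'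
        proof
          fix w assume w: "w \<in> A'"
          then obtain i where "i \<in> I" "w = x i" using A' I' by blast
          then show "w \<in> S k" using x[of i k] k w A' by metis
        qed
        have "A \<subseteq> S k \<or> B \<subseteq> S k" using sub[of A] sub[of B] AB by blast
        then show ?thesis using y conv_subset[OF psubset.prems(1)[OF k]] by blast
      qed
      then show ?thesis by blast
    qed
  qed
qed

text \<open>To add a coordinate \<open>k\<close>, keep \<open>N\<close> of its values and recolour
  each point of the smaller grid by the vector of the \<open>N\<close> colours above it. The
  induction hypothesis, used with \<open>h ^ N\<close> colours, makes this vector constant on a
  subgrid, and the vector itself repeats a colour often enough.\<close>

lemma product_pigeonhole:
  fixes K :: "nat set"
  assumes "finite K" "t \<ge> 1"
  shows "\<exists>R. \<forall>G (c::(nat \<Rightarrow> nat) \<Rightarrow> nat).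
    (\<forall>i\<in>K. R \<le> card (G i)) \<and> (\<forall>x\<in>PiE K G. c x < h) \<longrightarrow>
    (\<exists>H a. (\<forall>i\<in>K. H i \<subseteq> G i \<and> t \<le> card (H i)) \<and> (\<forall>x\<in>PiE K H. c x = a))"
  using assms(1)
proof (induction K arbitrary: h rule: finite_induct)
  case empty
  then show ?case by auto
next
  case (insert k K)
  \<comment> \<open>If each of \<open>h\<close> colours occurred at most \<open>t\<close> times, the
    vector would have at most \<open>h * t\<close> entries.\<close>
  define N where "N = h * t + 1"
  obtain R where R: "\<forall>G (c::(nat \<Rightarrow> nat) \<Rightarrow> nat).
    (\<forall>i\<in>K. R \<le> card (G i)) \<and> (\<forall>x\<in>PiE K G. c x < h ^ N) \<longrightarrow>
    (\<exists>H a. (\<forall>i\<in>K. H i \<subseteq> G i \<and> t \<le> card (H i)) \<and> (\<forall>x\<in>PiE K H. c x = a))"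
    using insert.IH[of "h ^ N"] by (rule exE)
  show ?case
  proof (intro exI[of _ "max R N"] allI impI, elim conjE)
    fix G and c :: "(nat \<Rightarrow> nat) \<Rightarrow> nat"
    assume G: "\<forall>i\<in>insert k K. max R N \<le> card (G i)" and c: "\<forall>x\<in>PiE (insert k K) G. c x < h"
    obtain V where V: "V \<subseteq> G k" "card V = N" "finite V"
      using G by (metis insertI1 max.boundedE obtain_subset_with_card_n)
    define g where "g x = restrict (\<lambda>v. c (x(k := v))) V" for x
    have g: "g x \<in> PiE V (\<lambda>_. {..<h})" if "x \<in> PiE K G" for x
    proof -
      have "x(k := v) \<in> PiE (insert k K) G" if "v \<in> V" for v
        using \<open>x \<in> PiE K G\<close> that V(1) by (auto simp: PiE_iff extensional_def)
      then show ?thesis using c unfolding g_def by auto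
    qed
    have "card (PiE V (\<lambda>_. {..<h})) = h ^ N" using V by (simp add: card_PiE)
    moreover have "finite (PiE V (\<lambda>_. {..<h}))" using V by (simp add: finite_PiE)
    ultimately obtain e where e: "bij_betw e (PiE V (\<lambda>_. {..<h})) {0..<h ^ N}"
      using ex_bij_betw_finite_nat by metis
    have "\<forall>x\<in>PiE K G. e (g x) < h ^ N" using g e by (auto simp: bij_betw_def)
    then obtain H a where "\<forall>i\<in>K. H i \<subseteq> G i \<and> t \<le> card (H i)" "\<forall>x\<in>PiE K H. e (g x) = a"
      using R[rule_format, of G "\<lambda>x. e (g x)"] G by auto
    note H = bspec[OF this(1)] and a = bspec[OF this(2)]
    have "PiE K H \<noteq> {}"
      using H assms(2) by (force simp: PiE_eq_empty_iff)
    then obtain x0 where x0: "x0 \<in> PiE K H" by blast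
    have HG: "PiE K H \<subseteq> PiE K G" using H by (intro PiE_mono) auto
    have gx: "g x = g x0" if "x \<in> PiE K H" for x
      using a[OF that] a[OF x0] g[OF subsetD[OF HG that]] g[OF subsetD[OF HG x0]]
      by (intro inj_onD[OF bij_betw_imp_inj_on[OF e]]) auto
    have "\<exists>b. t \<le> card {v\<in>V. g x0 v = b}"
    proof (rule ccontr)
      assume "\<nexists>b. t \<le> card {v\<in>V. g x0 v = b}"
      then have less: "card {v\<in>V. g x0 v = b} \<le> t" for b by (meson nat_le_linear)
      have "V \<subseteq> (\<Union>b\<in>{..<h}. {v\<in>V. g x0 v = b})"
        using g[of x0] x0 HG by blast
      then have "card V \<le> card (\<Union>b\<in>{..<h}. {v\<in>V. g x0 v = b})"
        using V by (intro card_mono) auto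
      also have "\<dots> \<le> (\<Sum>b<h. card {v\<in>V. g x0 v = b})" by (rule card_UN_le) simp
      also have "\<dots> \<le> (\<Sum>b<h. t)" by (intro sum_mono less)
      finally show False using V by (simp add: N_def)
    qed
    then obtain b where b: "t \<le> card {v\<in>V. g x0 v = b}" by blast
    show "\<exists>H a. (\<forall>i\<in>insert k K. H i \<subseteq> G i \<and> t \<le> card (H i)) \<and> (\<forall>x\<in>PiE (insert k K) H. c x = a)"
    proof (intro exI[of _ "H(k := {v\<in>V. g x0 v = b})"] exI[of _ b] conjI ballI)
      fix x assume x: "x \<in> PiE (insert k K) (H(k := {v\<in>V. g x0 v = b}))"
      define y where "y = x(k := undefined)"
      have y: "y \<in> PiE K H"
        using x insert.hyps unfolding y_def by (fastforce simp: PiE_iff extensional_def)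
      have xk: "x k \<in> V" "g x0 (x k) = b" using x by (auto simp: PiE_iff)
      have "c x = g y (x k)" unfolding g_def y_def using xk by simp
      then show "c x = b" using gx[OF y] xk by simp
    qed (use H b V insert.hyps in auto)
  qed
qed

section \<open>Small sets, centres and covers of grids\<close>

definition grid_in :: "(nat \<Rightarrow> nat set) \<Rightarrow> nat set \<Rightarrow> nat \<Rightarrow> (nat \<Rightarrow> nat) set \<Rightarrow> bool" where
  "grid_in G K t B \<longleftrightarrow> (\<exists>H. (\<forall>i\<in>K. H i \<subseteq> G i \<and> t \<le> card (H i)) \<and> PiE K H \<subseteq> B)"

text \<open>A centrepoint in which the small sets are those without a subgrid of side
  \<open>t\<close>. If no set is small, as can happen for \<open>t = 0\<close>, the second clause is
  vacuous and only \<open>z \<in> X\<close> keeps the point inside the space.\<close>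

definition centre ::
  "'a set \<Rightarrow> 'a set set \<Rightarrow> ((nat \<Rightarrow> nat) \<Rightarrow> 'a) \<Rightarrow> (nat \<Rightarrow> nat set) \<Rightarrow> nat set \<Rightarrow> nat \<Rightarrow> 'a \<Rightarrow> bool" where
  "centre X C q G K t z \<longleftrightarrow> z \<in> X \<and>
     (\<forall>B \<subseteq> PiE K G. \<not> grid_in G K t B \<longrightarrow> z \<in> conv C (q ` (PiE K G - B)))"

definition grid_ramsey :: "nat set \<Rightarrow> nat \<Rightarrow> nat \<Rightarrow> nat \<Rightarrow> bool" where
  "grid_ramsey K h t R \<longleftrightarrow> (\<forall>G \<B>. (\<forall>i\<in>K. R \<le> card (G i)) \<and> finite \<B> \<and> card \<B> \<le> h \<and>
     PiE K G \<subseteq> \<Union>\<B> \<longrightarrow> (\<exists>B\<in>\<B>. grid_in G K t B))"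

lemma grid_ramsey_mono: "grid_ramsey K h t R \<Longrightarrow> R \<le> R' \<Longrightarrow> grid_ramsey K h t R'"
  unfolding grid_ramsey_def by (meson order_trans)

text \<open>Colour each grid point by the number of a covering set that contains it; a monochromatic
  subgrid lies inside that set.\<close>

lemma grid_ramsey_exists:
  assumes "finite K"
  shows "\<exists>R. grid_ramsey K h t R"
proof -
  \<comment> \<open>Side \<open>Suc t\<close> keeps the monochromatic subgrid non-empty even for
    \<open>t = 0\<close>, so that a colour can be read off at \<open>x0\<close>.\<close>
  obtain R where R: "\<forall>G (c::(nat \<Rightarrow> nat) \<Rightarrow> nat).
    (\<forall>i\<in>K. R \<le> card (G i)) \<and> (\<forall>x\<in>PiE K G. c x < h) \<longrightarrow>
    (\<exists>H a. (\<forall>i\<in>K. H i \<subseteq> G i \<and> Suc t \<le> card (H i)) \<and> (\<forall>x\<in>PiE K H. c x = a))"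
    using product_pigeonhole[OF assms, of "Suc t" h] by (elim meta_impE exE) auto
  have "\<exists>B\<in>\<B>. grid_in G K t B"
    if G: "\<forall>i\<in>K. R \<le> card (G i)" and \<B>: "finite \<B>" "card \<B> \<le> h" "PiE K G \<subseteq> \<Union>\<B>" for G \<B>
  proof -
    obtain e where e: "bij_betw e \<B> {0..<card \<B>}"
      using ex_bij_betw_finite_nat[OF \<B>(1)] by blast
    have "\<forall>x\<in>PiE K G. \<exists>B. B \<in> \<B> \<and> x \<in> B" using \<B> by blast
    then obtain b where b: "\<And>x. x \<in> PiE K G \<Longrightarrow> b x \<in> \<B> \<and> x \<in> b x" by metis
    have "\<forall>x\<in>PiE K G. e (b x) < h"
    proof
      fix x assume "x \<in> PiE K G"
      then have "e (b x) \<in> {0..<card \<B>}" using bij_betwE[OF e] b by blast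
      then show "e (b x) < h" using \<B>(2) by simp
    qed
    then obtain H a where "\<forall>i\<in>K. H i \<subseteq> G i \<and> Suc t \<le> card (H i)" "\<forall>x\<in>PiE K H. e (b x) = a"
      using R[rule_format, of G "\<lambda>x. e (b x)"] G by auto
    note H = bspec[OF this(1)] and a = bspec[OF this(2)]
    have HG: "PiE K H \<subseteq> PiE K G" using H by (intro PiE_mono) auto
    have "PiE K H \<noteq> {}" using H by (force simp: PiE_eq_empty_iff)
    then obtain x0 where x0: "x0 \<in> PiE K H" by blast
    have "b x = b x0" if "x \<in> PiE K H" for x
      using a[OF that] a[OF x0] b[OF subsetD[OF HG that]] b[OF subsetD[OF HG x0]]
      by (intro inj_onD[OF bij_betw_imp_inj_on[OF e]]) auto
    then have sub: "PiE K H \<subseteq> b x0" using b HG by (metis subset_eq)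
    have "grid_in G K t (b x0)" unfolding grid_in_def
      by (intro exI[of _ H] conjI ballI sub) (auto dest!: H)
    then show ?thesis using b x0 HG by blast
  qed
  then show ?thesis unfolding grid_ramsey_def by blast
qed

context radon_space
begin

text \<open>Helly's theorem for the hulls that remain after removing a small set: at most
  \<open>h\<close> small sets leave some grid point \<open>x\<close> uncovered, and
  \<open>q x\<close> then lies in all their hulls.\<close>

lemma centre_exists:
  assumes K: "finite K" and fin: "\<And>i. i \<in> K \<Longrightarrow> finite (G i)"
    and R: "grid_ramsey K h t R" "\<And>i. i \<in> K \<Longrightarrow> R \<le> card (G i)"
    and q: "q ` PiE K G \<subseteq> X"
  shows "\<exists>z. centre X C q G K t z"
proof -
  define I where "I = {B. B \<subseteq> PiE K G \<and> \<not> grid_in G K t B}"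
  have "(\<Inter>B\<in>I. conv C (q ` (PiE K G - B))) \<noteq> {}"
  proof (rule helly)
    have "I \<subseteq> Pow (PiE K G)" unfolding I_def by blast
    moreover have "finite (PiE K G)" using K fin by (rule finite_PiE)
    ultimately show I: "finite I" by (meson finite_Pow_iff finite_subset)
    show "conv C (q ` (PiE K G - B)) \<in> C" for B
      using conv_in[OF convexity] q by (meson Diff_subset image_mono subset_trans)
    fix L assume L: "L \<subseteq> I" "card L \<le> h"
    have "\<not> PiE K G \<subseteq> \<Union>L"
    proof
      assume "PiE K G \<subseteq> \<Union>L"
      then have "\<exists>B\<in>L. grid_in G K t B"
        using R(1)[unfolded grid_ramsey_def, rule_format, of G L] R(2) L(2) finite_subset[OF L(1) I]
        by auto
      then show False using L unfolding I_def by blast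
    qed
    then obtain x where "x \<in> PiE K G" "x \<notin> \<Union>L" by blast
    then have "q x \<in> q ` (PiE K G - B)" if "B \<in> L" for B using that by auto
    then have "q x \<in> (\<Inter>B\<in>L. conv C (q ` (PiE K G - B)))"
      by (intro INT_I subsetD[OF subset_conv])
    then show "(\<Inter>B\<in>L. conv C (q ` (PiE K G - B))) \<noteq> {}" by blast
  qed
  then obtain z where z: "z \<in> (\<Inter>B\<in>I. conv C (q ` (PiE K G - B)))" by blast
  have X: "X \<noteq> {}" "X \<in> C" using convexity unfolding convexity_space_def by simp_all
  show ?thesis
  proof (cases "I = {}")
    case True
    obtain z where "z \<in> X" using X(1) by blast
    moreover have "grid_in G K t B" if "B \<subseteq> PiE K G" for B
      using True that unfolding I_def by simp
    ultimately show ?thesis unfolding centre_def by (intro exI[of _ z]) simp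
  next
    case False
    then obtain B where "B \<in> I" by blast
    then have "z \<in> conv C (q ` (PiE K G - B))" using z by blast
    moreover have "conv C (q ` (PiE K G - B)) \<subseteq> X"
      by (rule conv_subset[OF X(2) subset_trans[OF image_mono[OF Diff_subset] q]])
    ultimately have "z \<in> X" by blast
    then show ?thesis using z unfolding centre_def I_def by (intro exI[of _ z]) simp
  qed
qed

text \<open>The set of grid points outside the halfspace must contain a grid, since otherwise the centre
  would lie in the hull of the points inside the halfspace.\<close>

lemma halfspace_avoids_grid:
  assumes sep: "separable X C" and A: "A \<in> C"
    and z: "centre X C q G K t z" "z \<notin> A"
  shows "\<exists>\<gamma>\<in>halfspaces X C. A \<subseteq> \<gamma> \<and> grid_in G K t {x \<in> PiE K G. q x \<notin> \<gamma>}"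
proof -
  have "z \<in> X" using z(1)[unfolded centre_def] by (rule conjunct1)
  then obtain \<gamma> where \<gamma>: "\<gamma> \<in> halfspaces X C" "A \<subseteq> \<gamma>" "z \<notin> \<gamma>"
    using sep A z(2) unfolding separable_def by blast
  define B where "B = {x \<in> PiE K G. q x \<notin> \<gamma>}"
  have "q ` (PiE K G - B) \<subseteq> \<gamma>" unfolding B_def by blast
  then have "conv C (q ` (PiE K G - B)) \<subseteq> \<gamma>"
    using \<gamma>(1) by (intro conv_subset) (auto simp: halfspaces_def)
  then have "z \<notin> conv C (q ` (PiE K G - B))" using \<gamma>(3) by auto
  moreover have "B \<subseteq> PiE K G" unfolding B_def by auto
  ultimately have "grid_in G K t B"
    using z(1)[unfolded centre_def] by auto
  then show ?thesis using \<gamma> unfolding B_def by blast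
qed

end

section \<open>Refining grids\<close>

text \<open>\<open>S j r s G\<close> will say that on the grid \<open>G\<close> a halfspace containing the \<open>r\<close>-th set of class \<open>j\<close>
  misses all points with \<open>j\<close>-th coordinate \<open>s\<close>. All pairs \<open>r, s\<close> of a class are treated before
  passing to the next one, since later refinements may delete any given pair.\<close>

definition refinable ::
  "nat \<Rightarrow> (nat \<Rightarrow> nat) \<Rightarrow> nat set \<Rightarrow> (nat \<Rightarrow> nat \<Rightarrow> nat \<Rightarrow> (nat \<Rightarrow> nat set) \<Rightarrow> bool) \<Rightarrow> bool" where
  "refinable D R W S \<longleftrightarrow>
    (\<forall>j r s G H. S j r s G \<longrightarrow> (\<forall>i. H i \<subseteq> G i) \<longrightarrow> S j r s H) \<and>
    (\<forall>j r s t G. j < D \<longrightarrow> r \<in> G j \<longrightarrow> s \<in> G j \<longrightarrow> (\<forall>i. G i \<subseteq> W) \<longrightarrow>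
      (\<forall>i<D. i \<noteq> j \<longrightarrow> R t \<le> card (G i)) \<longrightarrow>
      (\<exists>H. H j = G j \<and> (\<forall>i. H i \<subseteq> G i) \<and> (\<forall>i<D. i \<noteq> j \<longrightarrow> t \<le> card (H i)) \<and> S j r s H))"

lemma refinable_mono:
  "refinable D R W S \<Longrightarrow> S j r s G \<Longrightarrow> \<forall>i. H i \<subseteq> G i \<Longrightarrow> S j r s H"
  unfolding refinable_def by blast

lemma refinable_step:
  assumes "refinable D R W S" "j < D" "r \<in> G j" "s \<in> G j" "\<forall>i. G i \<subseteq> W"
    "\<forall>i<D. i \<noteq> j \<longrightarrow> R t \<le> card (G i)"
  obtains H where "H j = G j" "\<forall>i. H i \<subseteq> G i" "\<forall>i<D. i \<noteq> j \<longrightarrow> t \<le> card (H i)" "S j r s H"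
  using assms unfolding refinable_def by metis

text \<open>Each pair costs one application of \<open>R\<close> to the sizes in the other classes.
  Class \<open>j\<close> stays fixed, so the remaining pairs stay available, and settled pairs
  survive by monotonicity.\<close>

lemma grid_refine_pairs:
  assumes ref: "refinable D R W S" and j: "j < D"
    and P: "finite P" "P \<subseteq> G j \<times> G j" and G: "\<forall>i. G i \<subseteq> W"
      "\<forall>i<D. i \<noteq> j \<longrightarrow> (R ^^ card P) t \<le> card (G i)"
  shows "\<exists>H. H j = G j \<and> (\<forall>i. H i \<subseteq> G i) \<and> (\<forall>i<D. i \<noteq> j \<longrightarrow> t \<le> card (H i)) \<and>
      (\<forall>(r, s)\<in>P. S j r s H)"
  using P G
proof (induction P arbitrary: G rule: finite_induct)
  case empty
  then show ?case by (intro exI[of _ G]) auto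
next
  case (insert p P)
  obtain r s where p: "p = (r, s)" by force
  have "\<forall>i<D. i \<noteq> j \<longrightarrow> R ((R ^^ card P) t) \<le> card (G i)"
    using insert.prems(3) insert.hyps by simp
  then obtain H where H: "H j = G j" "\<forall>i. H i \<subseteq> G i" "\<forall>i<D. i \<noteq> j \<longrightarrow> (R ^^ card P) t \<le> card (H i)"
      "S j r s H"
    using refinable_step[OF ref j, of r G s "(R ^^ card P) t"] insert.prems(1,2) p by auto
  have HW: "\<forall>i. H i \<subseteq> W" using H(2) insert.prems(2) by blast
  have "P \<subseteq> H j \<times> H j" using insert.prems(1) H(1) by simp
  from insert.IH[OF this HW H(3)] obtain H' where H': "H' j = H j" "\<forall>i. H' i \<subseteq> H i"
      "\<forall>i<D. i \<noteq> j \<longrightarrow> t \<le> card (H' i)" "\<forall>(r, s)\<in>P. S j r s H'"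
    by (elim exE conjE)
  have "S j r s H'" using refinable_mono[OF ref H(4) H'(2)] .
  moreover have "\<forall>i. H' i \<subseteq> G i" using H(2) H'(2) by blast
  ultimately show ?case
    using H(1) H' p by (intro exI[of _ H']) simp
qed

text \<open>Class \<open>j\<close> is first cut to exactly \<open>t\<close> members, which fixes the
  number of pairs at \<open>t * t\<close> and so the number of iterations of
  \<open>R\<close>.\<close>

lemma grid_refine_class:
  assumes ref: "refinable D R W S" and j: "j < D" and GW: "\<forall>i. G i \<subseteq> W"
    and G: "\<forall>i<D. max t ((R ^^ (t * t)) t) \<le> card (G i)"
  shows "\<exists>H. (\<forall>i. H i \<subseteq> G i) \<and> (\<forall>i<D. t \<le> card (H i)) \<and> (\<forall>r\<in>H j. \<forall>s\<in>H j. S j r s H)"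
proof -
  obtain V where V: "V \<subseteq> G j" "card V = t" "finite V"
    using G j by (metis max.boundedE obtain_subset_with_card_n)
  have "\<exists>H. H j = (G(j := V)) j \<and> (\<forall>i. H i \<subseteq> (G(j := V)) i) \<and>
      (\<forall>i<D. i \<noteq> j \<longrightarrow> t \<le> card (H i)) \<and> (\<forall>(r, s)\<in>V \<times> V. S j r s H)"
  proof (rule grid_refine_pairs[OF ref j])
    show "\<forall>i. (G(j := V)) i \<subseteq> W" using GW V by auto
    show "\<forall>i<D. i \<noteq> j \<longrightarrow> (R ^^ card (V \<times> V)) t \<le> card ((G(j := V)) i)"
      using G V by (simp add: card_cartesian_product)
  qed (use V in auto)
  then obtain H where H: "H j = V" "\<forall>i. H i \<subseteq> (G(j := V)) i"
      "\<forall>i<D. i \<noteq> j \<longrightarrow> t \<le> card (H i)" "\<forall>(r, s)\<in>V \<times> V. S j r s H" by auto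
  have "H i \<subseteq> G i" for i using spec[OF H(2), of i] V(1) by (auto split: if_splits)
  moreover have "t \<le> card (H i)" if "i < D" for i using H(1,3) V that by (cases "i = j") auto
  ultimately show ?thesis
    using H by (intro exI[of _ H]) auto
qed

text \<open>The highest class is settled first and leaves grids of side \<open>T\<close>, just what
  the induction hypothesis needs for the classes below it.\<close>

lemma grid_refine:
  assumes ref: "refinable D R W S" and m: "m \<le> D" and GW: "\<forall>i. G i \<subseteq> W"
    and G: "\<forall>i<D. ((\<lambda>t. max t ((R ^^ (t * t)) t)) ^^ m) t \<le> card (G i)"
  shows "\<exists>H. (\<forall>i. H i \<subseteq> G i) \<and> (\<forall>i<D. t \<le> card (H i)) \<and>
      (\<forall>j<m. \<forall>r\<in>H j. \<forall>s\<in>H j. S j r s H)"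
  using m GW G
proof (induction m arbitrary: G)
  case 0
  then show ?case by (intro exI[of _ G]) auto
next
  case (Suc m)
  define T where "T = ((\<lambda>t. max t ((R ^^ (t * t)) t)) ^^ m) t"
  have mD: "m < D" using Suc.prems by simp
  have "\<forall>i<D. max T ((R ^^ (T * T)) T) \<le> card (G i)"
    using Suc.prems(3) by (simp add: T_def)
  from grid_refine_class[OF ref mD Suc.prems(2) this]
  obtain H where H: "\<forall>i. H i \<subseteq> G i" "\<forall>i<D. T \<le> card (H i)"
    "\<forall>r\<in>H m. \<forall>s\<in>H m. S m r s H" by (elim exE conjE)
  have "\<forall>i. H i \<subseteq> W" using H(1) Suc.prems(2) by blast
  from Suc.IH[OF _ this H(2)[unfolded T_def]] mD
  obtain H' where H': "\<forall>i. H' i \<subseteq> H i" "\<forall>i<D. t \<le> card (H' i)"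
    "\<forall>j<m. \<forall>r\<in>H' j. \<forall>s\<in>H' j. S j r s H'" by auto
  have "S m r s H'" if "r \<in> H' m" "s \<in> H' m" for r s
    using refinable_mono[OF ref _ H'(1)] H(3) H'(1) that by blast
  moreover have "\<forall>i. H' i \<subseteq> G i" using H(1) H'(1) by blast
  ultimately show ?case
    using H'(2,3) by (intro exI[of _ H']) (simp add: less_Suc_eq_le le_less)
qed

text \<open>Fix \<open>r j \<noteq> s j\<close> in each class and a halfspace separating the set
  \<open>r j\<close> from the points with coordinate \<open>s j\<close>. Choosing \<open>r j\<close>
  or \<open>s j\<close> independently in each class gives a point of every region.\<close>

lemma complete_venn_of_grid:
  fixes H :: "nat \<Rightarrow> nat set"
  assumes card: "\<And>j. j < D \<Longrightarrow> 2 \<le> card (H j)"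
    and pt: "\<And>x j. x \<in> PiE {..<D} H \<Longrightarrow> j < D \<Longrightarrow> pt x \<in> A j (x j)"
    and X: "\<And>x. x \<in> PiE {..<D} H \<Longrightarrow> pt x \<in> X"
    and sep: "\<And>j r s. j < D \<Longrightarrow> r \<in> H j \<Longrightarrow> s \<in> H j \<Longrightarrow> r \<noteq> s \<Longrightarrow>
      \<exists>\<gamma>\<in>\<Gamma>. A j r \<subseteq> \<gamma> \<and> (\<forall>x\<in>PiE {..<D} H. x j = s \<longrightarrow> pt x \<notin> \<gamma>)"
  shows "has_complete_venn X \<Gamma> D"
proof -
  have "\<exists>r s. r \<in> H j \<and> s \<in> H j \<and> r \<noteq> s" if j: "j < D" for j
  proof -
    obtain U where "U \<subseteq> H j" "card U = 2" using card[OF j] by (meson obtain_subset_with_card_n)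
    then show ?thesis by (auto simp: card_2_iff)
  qed
  then obtain r s where rs: "\<And>j. j < D \<Longrightarrow> r j \<in> H j \<and> s j \<in> H j \<and> r j \<noteq> s j" by metis
  then have "\<forall>j. \<exists>\<gamma>. j < D \<longrightarrow> \<gamma> \<in> \<Gamma> \<and> A j (r j) \<subseteq> \<gamma> \<and> (\<forall>x\<in>PiE {..<D} H. x j = s j \<longrightarrow> pt x \<notin> \<gamma>)"
    using sep by blast
  then obtain \<gamma> where \<gamma>: "\<And>j. j < D \<Longrightarrow> \<gamma> j \<in> \<Gamma>" "\<And>j. j < D \<Longrightarrow> A j (r j) \<subseteq> \<gamma> j"
    "\<And>j x. j < D \<Longrightarrow> x \<in> PiE {..<D} H \<Longrightarrow> x j = s j \<Longrightarrow> pt x \<notin> \<gamma> j"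
    by metis
  define x where "x P = restrict (\<lambda>j. if P j then r j else s j) {..<D}" for P
  have x: "x P \<in> PiE {..<D} H" for P using rs unfolding x_def by auto
  have iff: "pt (x P) \<in> \<gamma> j \<longleftrightarrow> P j" if j: "j < D" for P j
  proof (cases "P j")
    case True
    then have "x P j = r j" using j by (simp add: x_def)
    then show ?thesis using True pt[OF x[of P] j] \<gamma>(2)[OF j] by auto
  next
    case False
    then have "x P j = s j" using j by (simp add: x_def)
    then show ?thesis using False \<gamma>(3)[OF j x[of P]] by auto
  qed
  \<comment> \<open>The Venn diagram is one of a set of halfspaces, so they must be distinct: the
    point whose predicate holds at a single index lies in that halfspace alone.\<close>
  have inj: "inj_on \<gamma> {..<D}"
    using iff[of _ "\<lambda>j. j = _"] by (intro inj_onI) (metis lessThan_iff)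
  show ?thesis unfolding has_complete_venn_def
  proof (intro exI[of _ "\<gamma> ` {..<D}"] conjI allI impI)
    show "card (\<gamma> ` {..<D}) = D" using inj by (simp add: card_image)
    show "\<exists>y\<in>X. \<forall>\<delta>\<in>\<gamma> ` {..<D}. (y \<in> \<delta>) = (\<delta> \<in> T)" if "T \<subseteq> \<gamma> ` {..<D}" for T
      using X[OF x] iff[of _ "\<lambda>j. \<gamma> j \<in> T"] by (intro bexI[of _ "pt (x (\<lambda>j. \<gamma> j \<in> T))"]) auto
  qed (use \<gamma> in auto)
qed

section \<open>Supersaturation\<close>

lemma card_PiE_insert_Collect:
  assumes "finite I" "k \<notin> I" "\<And>i. i \<in> insert k I \<Longrightarrow> finite (F i)"
  shows "card {f \<in> PiE (insert k I) F. Q f} = (\<Sum>f\<in>PiE I F. card {w \<in> F k. Q (f(k := w))})"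
proof -
  have "{f \<in> PiE (insert k I) F. Q f} =
      (\<lambda>(f, w). f(k := w)) ` (SIGMA f:PiE I F. {w \<in> F k. Q (f(k := w))})"
  proof (intro equalityI subsetI)
    fix f assume f: "f \<in> {f \<in> PiE (insert k I) F. Q f}"
    then have "(f(k := undefined), f k) \<in> (SIGMA f:PiE I F. {w \<in> F k. Q (f(k := w))})"
      using fun_upd_in_PiE[OF assms(2)] by auto
    then show "f \<in> (\<lambda>(f, w). f(k := w)) ` (SIGMA f:PiE I F. {w \<in> F k. Q (f(k := w))})"
      by (rule rev_image_eqI) simp
  qed (auto intro!: PiE_fun_upd)
  moreover have "inj_on (\<lambda>(f, w). f(k := w)) (SIGMA f:PiE I F. {w \<in> F k. Q (f(k := w))})"
  proof (rule inj_onI)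
    fix p p' :: "('a \<Rightarrow> 'b) \<times> 'b"
    assume p: "p \<in> (SIGMA f:PiE I F. {w \<in> F k. Q (f(k := w))})"
      and p': "p' \<in> (SIGMA f:PiE I F. {w \<in> F k. Q (f(k := w))})"
      and eq: "(case p of (f, w) \<Rightarrow> f(k := w)) = (case p' of (f, w) \<Rightarrow> f(k := w))"
    obtain f w g v where fg: "p = (f, w)" "p' = (g, v)" by force
    have eq': "f(k := w) = g(k := v)" using eq fg by simp
    have f: "f \<in> PiE I F" and g: "g \<in> PiE I F" using p p' fg by simp_all
    have "f x = g x" for x
      using fun_cong[OF eq', of x] PiE_arb[OF f assms(2)] PiE_arb[OF g assms(2)] by (cases "x = k") simp_all
    then have "f = g" by (rule ext)
    moreover have "w = v" using fun_cong[OF eq', of k] by simp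
    ultimately show "p = p'" using fg by simp
  qed
  ultimately have "card {f \<in> PiE (insert k I) F. Q f} =
      card (SIGMA f:PiE I F. {w \<in> F k. Q (f(k := w))})"
    by (simp add: card_image)
  also have "\<dots> = (\<Sum>f\<in>PiE I F. card {w \<in> F k. Q (f(k := w))})"
    using assms by (intro card_SigmaI) (auto intro: finite_PiE)
  finally show ?thesis .
qed

text \<open>The counting form of a conditional probability bound: all coordinates but
  \<open>k\<close> are fixed first.\<close>

lemma card_PiE_Collect_le:
  fixes q :: real
  assumes "finite I" "finite W" "k \<in> I"
    and q: "\<And>f. f \<in> PiE (I - {k}) (\<lambda>_. W) \<Longrightarrow> real (card {w \<in> W. Q (f(k := w))}) \<le> q"
  shows "real (card {f \<in> PiE I (\<lambda>_. W). Q f}) \<le> q * real (card W) ^ (card I - 1)"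
proof -
  have "insert k (I - {k}) = I" using assms by auto
  then have "real (card {f \<in> PiE I (\<lambda>_. W). Q f}) =
      (\<Sum>f\<in>PiE (I - {k}) (\<lambda>_. W). real (card {w \<in> W. Q (f(k := w))}))"
    using card_PiE_insert_Collect[of "I - {k}" k "\<lambda>_. W" Q] assms by simp
  also have "\<dots> \<le> (\<Sum>f\<in>PiE (I - {k}) (\<lambda>_. W). q)"
    by (intro sum_mono q)
  also have "\<dots> = q * real (card W) ^ (card I - 1)"
    using assms by (simp add: card_PiE)
  finally show ?thesis .
qed

lemma sum_card_swap:
  assumes "finite U" "finite W"
  shows "(\<Sum>u\<in>U. real (card {w \<in> W. Q u w})) = (\<Sum>w\<in>W. real (card {u \<in> U. Q u w}))"
proof -
  have "(\<Sum>u\<in>U. real (card {w \<in> W. Q u w})) = (\<Sum>u\<in>U. \<Sum>w\<in>W. of_bool (Q u w))"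
    using assms by (simp add: of_bool_def sum.If_cases Int_def)
  also have "\<dots> = (\<Sum>w\<in>W. \<Sum>u\<in>U. of_bool (Q u w))" by (rule sum.swap)
  also have "\<dots> = (\<Sum>w\<in>W. real (card {u \<in> U. Q u w}))"
    using assms by (simp add: of_bool_def sum.If_cases Int_def)
  finally show ?thesis .
qed

text \<open>A reverse Markov inequality: terms below the threshold contribute at most half of the
  guaranteed sum, so the others, each at most \<open>b\<close>, must be numerous.\<close>

lemma card_large_terms:
  fixes f :: "'b \<Rightarrow> real"
  assumes "finite U" "\<And>u. u \<in> U \<Longrightarrow> f u \<le> b" "b > 0"
    and "(\<Sum>u\<in>U. f u) \<ge> \<epsilon> * b * real (card U)"
  shows "real (card {u \<in> U. f u \<ge> \<epsilon> / 2 * b}) \<ge> \<epsilon> / 2 * real (card U)"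
proof -
  define L where "L = {u \<in> U. f u \<ge> \<epsilon> / 2 * b}"
  have L: "L \<subseteq> U" "finite L" using assms(1) by (auto simp: L_def)
  show ?thesis
  proof (cases "\<epsilon> \<ge> 0")
    case True
    have "\<epsilon> * b * real (card U) \<le> (\<Sum>u\<in>U. f u)" by fact
    also have "\<dots> = (\<Sum>u\<in>L. f u) + (\<Sum>u\<in>U - L. f u)"
      using sum.subset_diff[OF L(1) assms(1), of f] by simp
    also have "(\<Sum>u\<in>L. f u) \<le> (\<Sum>u\<in>L. b)" using assms L by (intro sum_mono) auto
    also have "(\<Sum>u\<in>U - L. f u) \<le> (\<Sum>u\<in>U - L. \<epsilon> / 2 * b)"
      by (intro sum_mono) (auto simp: L_def)
    also have "\<dots> \<le> (\<Sum>u\<in>U. \<epsilon> / 2 * b)"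
      using assms True by (intro sum_mono2) auto
    finally have "b * (\<epsilon> * real (card U)) \<le> b * (real (card L) + \<epsilon> / 2 * real (card U))"
      by (simp add: algebra_simps)
    then have "\<epsilon> * real (card U) \<le> real (card L) + \<epsilon> / 2 * real (card U)"
      using assms(3) by (simp only: mult_le_cancel_left_pos)
    then show ?thesis unfolding L_def by (simp add: algebra_simps)
  next
    case False
    then have "\<epsilon> / 2 * real (card U) \<le> 0" by (intro mult_nonpos_nonneg) auto
    then show ?thesis by (meson of_nat_0_le_iff order_trans)
  qed
qed

text \<open>Only those \<open>u\<close> with at least half the guaranteed average degree are kept.
  One factor \<open>\<epsilon> / 2\<close> is their proportion in \<open>U\<close>; the other
  \<open>T\<close> factors come from the degrees.\<close>

lemma dense_relation_power:
  assumes U: "finite U" and V: "finite V" "V \<noteq> {}" and "\<epsilon> > 0"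
    and dens: "(\<Sum>u\<in>U. real (card {v \<in> V. Q u v})) \<ge> \<epsilon> * real (card V) * real (card U)"
  shows "(\<Sum>u\<in>U. real (card {w \<in> PiE {..<T} (\<lambda>_. V). \<forall>i<T. Q u (w i)}))
     \<ge> (\<epsilon> / 2) ^ Suc T * real (card V) ^ T * real (card U)"
proof -
  define n where "n = real (card V)"
  have n: "n > 0" using V by (simp add: n_def card_gt_0_iff)
  define L where "L = {u \<in> U. real (card {v \<in> V. Q u v}) \<ge> \<epsilon> / 2 * n}"
  have eq: "{w \<in> PiE {..<T} (\<lambda>_. V). \<forall>i<T. Q u (w i)} = PiE {..<T} (\<lambda>_. {v \<in> V. Q u v})" for u
    by (auto simp: PiE_iff extensional_def)
  have cardL: "real (card L) \<ge> \<epsilon> / 2 * real (card U)" unfolding L_def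
  proof (rule card_large_terms)
    show "real (card {v \<in> V. Q u v}) \<le> n" for u
      unfolding n_def using V by (intro of_nat_mono card_mono) auto
    show "\<epsilon> * n * real (card U) \<le> (\<Sum>u\<in>U. real (card {v \<in> V. Q u v}))"
      using dens by (simp only: n_def)
  qed (use U n in auto)
  have "(\<epsilon> / 2) ^ Suc T * n ^ T * real (card U) = (\<epsilon> / 2 * real (card U)) * (\<epsilon> / 2 * n) ^ T"
    by (simp only: power_mult_distrib power_Suc mult_ac)
  also have "\<dots> \<le> real (card L) * (\<epsilon> / 2 * n) ^ T"
    using cardL n \<open>\<epsilon> > 0\<close> by (intro mult_right_mono) auto
  also have "\<dots> = (\<Sum>u\<in>L. (\<epsilon> / 2 * n) ^ T)" by simp
  also have "\<dots> \<le> (\<Sum>u\<in>L. real (card {v \<in> V. Q u v}) ^ T)"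
    using n \<open>\<epsilon> > 0\<close> by (intro sum_mono power_mono) (auto simp: L_def)
  also have "\<dots> \<le> (\<Sum>u\<in>U. real (card {v \<in> V. Q u v}) ^ T)"
    using U by (intro sum_mono2) (auto simp: L_def)
  finally show ?thesis unfolding eq n_def by (simp add: card_PiE)
qed

text \<open>Erdos's theorem on complete multipartite hypergraphs, in a counting form for samples
  with repetition. The last vertex is replaced by a \<open>T\<close>-tuple \<open>w\<close>; for a
  positive proportion of the \<open>w\<close> the common link of the entries is dense, and the
  induction hypothesis applies to that link.\<close>

lemma complete_multipartite_supersaturation:
  fixes T D :: nat
  assumes "\<epsilon> > 0"
  shows "\<exists>\<delta>>0. \<forall>(V::'b set) E. finite V \<longrightarrow> V \<noteq> {} \<longrightarrow>
    (\<forall>f g. (\<forall>j<D. f j = g j) \<longrightarrow> E f = E g) \<longrightarrow>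
    real (card {g \<in> PiE {..<D} (\<lambda>_. V). E g}) \<ge> \<epsilon> * real (card V) ^ D \<longrightarrow>
    real (card {f \<in> PiE {..<D} (\<lambda>_. PiE {..<T} (\<lambda>_. V)).
        \<forall>x\<in>PiE {..<D} (\<lambda>_. {..<T}). E (\<lambda>j. f j (x j))}) \<ge> \<delta> * real (card V) ^ (D * T)"
  using assms
proof (induction D arbitrary: \<epsilon>)
  case 0
  show ?case
  \<comment> \<open>For \<open>D = 0\<close> there is exactly one sample, so the constant must not
    exceed 1.\<close>
  proof (intro exI[of _ "min \<epsilon> 1"] conjI allI impI)
    fix V :: "'b set" and E :: "(nat \<Rightarrow> 'b) \<Rightarrow> bool"
    assume cong: "\<forall>f g. (\<forall>j<0. f j = g j) \<longrightarrow> E f = E g"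
      and dens: "\<epsilon> * real (card V) ^ 0 \<le> real (card {g \<in> PiE {..<0} (\<lambda>_. V). E g})"
    have "card {g \<in> PiE {..<0} (\<lambda>_. V). E g} > 0"
      using dens 0 by (simp del: lessThan_0)
    then have "{g \<in> PiE {..<0} (\<lambda>_. V). E g} \<noteq> {}"
      by (rule card_gt_0_iff[THEN iffD1, THEN conjunct1])
    then obtain g where g: "E g" by blast
    have E: "E f" for f using cong[rule_format, of f g] g by simp
    show "min \<epsilon> 1 * real (card V) ^ (0 * T) \<le> real (card {f \<in> PiE {..<0} (\<lambda>_. PiE {..<T} (\<lambda>_. V)).
        \<forall>x\<in>PiE {..<0} (\<lambda>_. {..<T}). E (\<lambda>j. f j (x j))})" by (simp add: E)
  qed (use 0 in auto)
next
  case (Suc D)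
  define \<epsilon>1 where "\<epsilon>1 = (\<epsilon> / 2) ^ Suc T"
  have \<epsilon>1: "\<epsilon>1 > 0" using Suc.prems by (simp add: \<epsilon>1_def)
  obtain \<delta> where \<delta>: "\<delta> > 0" and IH: "\<forall>(V::'b set) E. finite V \<longrightarrow> V \<noteq> {} \<longrightarrow>
    (\<forall>f g. (\<forall>j<D. f j = g j) \<longrightarrow> E f = E g) \<longrightarrow>
    real (card {g \<in> PiE {..<D} (\<lambda>_. V). E g}) \<ge> \<epsilon>1 / 2 * real (card V) ^ D \<longrightarrow>
    real (card {f \<in> PiE {..<D} (\<lambda>_. PiE {..<T} (\<lambda>_. V)).
        \<forall>x\<in>PiE {..<D} (\<lambda>_. {..<T}). E (\<lambda>j. f j (x j))}) \<ge> \<delta> * real (card V) ^ (D * T)"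
    using Suc.IH[of "\<epsilon>1 / 2"] \<epsilon>1 by auto
  show ?case
  proof (intro exI[of _ "\<epsilon>1 / 2 * \<delta>"] conjI allI impI)
    fix V :: "'b set" and E :: "(nat \<Rightarrow> 'b) \<Rightarrow> bool"
    assume V: "finite V" "V \<noteq> {}" and cong: "\<forall>f g. (\<forall>j<Suc D. f j = g j) \<longrightarrow> E f = E g"
      and dens: "\<epsilon> * real (card V) ^ Suc D \<le> real (card {g \<in> PiE {..<Suc D} (\<lambda>_. V). E g})"
    define n where "n = real (card V)"
    have n: "n > 0" using V by (simp add: n_def card_gt_0_iff)
    define W where "W = PiE {..<T} (\<lambda>_. V)"
    define U where "U = PiE {..<D} (\<lambda>_. V)"
    have W: "finite W" "real (card W) = n ^ T" using V by (auto simp: W_def n_def finite_PiE card_PiE)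
    have U: "finite U" "real (card U) = n ^ D" using V by (auto simp: U_def n_def finite_PiE card_PiE)
    \<comment> \<open>The common link of the entries of \<open>w\<close>. Double counting the pairs
      of \<open>g\<close> and \<open>w\<close> shows below that it is dense for many
      \<open>w\<close>, namely those in \<open>L\<close>.\<close>
    define Ew where "Ew w g \<longleftrightarrow> (\<forall>i<T. E (g(D := w i)))" for w g
    have "real (card {g \<in> PiE {..<Suc D} (\<lambda>_. V). E g}) = (\<Sum>g\<in>U. real (card {v \<in> V. E (g(D := v))}))"
      using card_PiE_insert_Collect[of "{..<D}" D "\<lambda>_. V" E] V
      by (simp add: lessThan_Suc U_def)
    then have "\<epsilon> * n * real (card U) \<le> (\<Sum>g\<in>U. real (card {v \<in> V. E (g(D := v))}))"
      using dens by (simp add: U n_def mult_ac)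
    then have "\<epsilon>1 * n ^ T * real (card U) \<le> (\<Sum>g\<in>U. real (card {w \<in> W. Ew w g}))"
      using dense_relation_power[of U V \<epsilon> "\<lambda>g v. E (g(D := v))" T] U V Suc.prems
      unfolding \<epsilon>1_def n_def W_def Ew_def by simp
    also have "(\<Sum>g\<in>U. real (card {w \<in> W. Ew w g})) = (\<Sum>w\<in>W. real (card {g \<in> U. Ew w g}))"
      using U(1) W(1) by (rule sum_card_swap)
    finally have sumW: "\<epsilon>1 * n ^ D * real (card W) \<le> (\<Sum>w\<in>W. real (card {g \<in> U. Ew w g}))"
      by (simp add: U W mult_ac)
    define L where "L = {w \<in> W. real (card {g \<in> U. Ew w g}) \<ge> \<epsilon>1 / 2 * n ^ D}"
    have L: "L \<subseteq> W" "finite L" using W by (auto simp: L_def)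
    have "real (card L) \<ge> \<epsilon>1 / 2 * real (card W)" unfolding L_def
    proof (rule card_large_terms)
      show "real (card {g \<in> U. Ew w g}) \<le> n ^ D" for w
        unfolding U(2)[symmetric] using U by (intro of_nat_mono card_mono) auto
    qed (use W n sumW in auto)
    define Full where "Full f \<longleftrightarrow> (\<forall>x\<in>PiE {..<Suc D} (\<lambda>_. {..<T}). E (\<lambda>j. f j (x j)))" for f
    have FullI: "Full (f(D := w))"
      if "\<forall>x\<in>PiE {..<D} (\<lambda>_. {..<T}). Ew w (\<lambda>j. f j (x j))" for f w
      unfolding Full_def
    proof
      fix x assume x: "x \<in> PiE {..<Suc D} (\<lambda>_. {..<T})"
      then have "x(D := undefined) \<in> PiE {..<D} (\<lambda>_. {..<T})"
        using fun_upd_in_PiE[of D "{..<D}" x] by (simp add: lessThan_Suc)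
      moreover have "x D < T" using x by auto
      ultimately have "E ((\<lambda>j. f j ((x(D := undefined)) j))(D := w (x D)))"
        using that unfolding Ew_def by blast
      then show "E (\<lambda>j. (f(D := w)) j (x j))"
        by (rule cong[rule_format, THEN iffD1, rotated]) auto
    qed
    have IHw: "\<delta> * n ^ (D * T) \<le> real (card {f \<in> PiE {..<D} (\<lambda>_. W). Full (f(D := w))})" if w: "w \<in> L" for w
    proof -
      have "\<delta> * n ^ (D * T) \<le> real (card {f \<in> PiE {..<D} (\<lambda>_. PiE {..<T} (\<lambda>_. V)).
        \<forall>x\<in>PiE {..<D} (\<lambda>_. {..<T}). Ew w (\<lambda>j. f j (x j))})"
        unfolding n_def
      proof (rule IH[rule_format, of V "Ew w"])
        show "Ew w f = Ew w g" if "\<And>j. j < D \<Longrightarrow> f j = g j" for f g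
        proof -
          have "E (f(D := v)) = E (g(D := v))" for v
            using that by (intro cong[rule_format]) (auto simp: less_Suc_eq)
          then show ?thesis unfolding Ew_def by simp
        qed
        show "\<epsilon>1 / 2 * real (card V) ^ D \<le> real (card {g \<in> PiE {..<D} (\<lambda>_. V). Ew w g})"
          using w unfolding L_def U_def n_def by simp
      qed (use V in auto)
      also have "\<dots> \<le> real (card {f \<in> PiE {..<D} (\<lambda>_. W). Full (f(D := w))})"
        using W(1) FullI by (intro of_nat_mono card_mono) (auto simp: W_def finite_PiE)
      finally show ?thesis .
    qed
    have "\<epsilon>1 / 2 * \<delta> * n ^ (Suc D * T) = \<epsilon>1 / 2 * real (card W) * (\<delta> * n ^ (D * T))"
      by (simp add: W power_add mult_ac)
    also have "\<dots> \<le> real (card L) * (\<delta> * n ^ (D * T))"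
      using \<open>real (card L) \<ge> _\<close> \<delta> n by (intro mult_right_mono) auto
    also have "\<dots> = (\<Sum>w\<in>L. \<delta> * n ^ (D * T))" by simp
    also have "\<dots> \<le> (\<Sum>w\<in>L. real (card {f \<in> PiE {..<D} (\<lambda>_. W). Full (f(D := w))}))"
      by (intro sum_mono IHw)
    also have "\<dots> \<le> (\<Sum>w\<in>W. real (card {f \<in> PiE {..<D} (\<lambda>_. W). Full (f(D := w))}))"
      using L W by (intro sum_mono2) auto
    also have "\<dots> = (\<Sum>f\<in>PiE {..<D} (\<lambda>_. W). real (card {w \<in> W. Full (f(D := w))}))"
      using W(1) by (intro sum_card_swap) (auto intro: finite_PiE)
    also have "\<dots> = real (card {f \<in> PiE {..<Suc D} (\<lambda>_. W). Full f})"
      using card_PiE_insert_Collect[of "{..<D}" D "\<lambda>_. W" Full] W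
      by (simp add: lessThan_Suc)
    finally show "\<epsilon>1 / 2 * \<delta> * real (card V) ^ (Suc D * T) \<le> real (card {f \<in> PiE {..<Suc D} (\<lambda>_. PiE {..<T} (\<lambda>_. V)).
        \<forall>x\<in>PiE {..<Suc D} (\<lambda>_. {..<T}). E (\<lambda>j. f j (x j))})"
      unfolding Full_def W_def n_def .
  qed (use \<epsilon>1 \<delta> in auto)
qed

section \<open>Random samples\<close>

text \<open>The deterministic half of the argument. In \<open>avoid\<close> the centre is a fixed
  choice determined by the points with \<open>j\<close>-th coordinate \<open>s\<close>, so that each
  condition is a single event for a random sample.\<close>

lemma (in radon_space) complete_venn_of_avoided_centres:
  fixes A :: "nat \<Rightarrow> nat \<Rightarrow> 'a set"
  assumes sep: "separable X C" and D: "D > 0"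
    and R: "\<And>j t. j < D \<Longrightarrow> grid_ramsey ({..<D} - {j}) h t (R t)" "\<And>t. t \<le> R t"
    and T: "T = ((\<lambda>t. max t ((R ^^ (t * t)) t)) ^^ D) 2"
    and A: "\<And>j i. j < D \<Longrightarrow> i < T \<Longrightarrow> A j i \<in> C"
    and pt: "\<And>x j. x \<in> PiE {..<D} (\<lambda>_. {..<T}) \<Longrightarrow> j < D \<Longrightarrow> pt x \<in> A j (x j)"
    and avoid: "\<And>j r s t G. j < D \<Longrightarrow> r < T \<Longrightarrow> s < T \<Longrightarrow> r \<noteq> s \<Longrightarrow> t \<le> T \<Longrightarrow>
      G \<in> PiE ({..<D} - {j}) (\<lambda>_. Pow {..<T}) \<Longrightarrow>
      (SOME z. centre X C (\<lambda>x. pt (x(j := s))) G ({..<D} - {j}) t z) \<notin> A j r"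
  shows "has_complete_venn X (halfspaces X C) D"
proof -
  have ptX: "pt x \<in> X" if "x \<in> PiE {..<D} (\<lambda>_. {..<T})" for x
  proof -
    have "x 0 < T" using that D by auto
    then have "A 0 (x 0) \<subseteq> X" using A[OF D] convexity unfolding convexity_space_def by blast
    then show ?thesis using pt[OF that D] by blast
  qed
  \<comment> \<open>Equal indices are exempt: a halfspace containing \<open>A j r\<close> contains
    the points with \<open>j\<close>-th coordinate \<open>r\<close>.\<close>
  define S where "S j r s G \<longleftrightarrow> r \<noteq> s \<longrightarrow>
    (\<exists>\<gamma>\<in>halfspaces X C. A j r \<subseteq> \<gamma> \<and> (\<forall>x\<in>PiE {..<D} G. x j = s \<longrightarrow> pt x \<notin> \<gamma>))"
    for j r s G
  have "refinable D R {..<T} S"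
    unfolding refinable_def
  proof (intro conjI allI impI)
    fix j r s and G H :: "nat \<Rightarrow> nat set"
    assume "S j r s G" and "\<forall>i. H i \<subseteq> G i"
    moreover from this have "PiE {..<D} H \<subseteq> PiE {..<D} G" by (intro PiE_mono) simp
    ultimately show "S j r s H" unfolding S_def by (meson subsetD)
  next
    fix j r s t and G :: "nat \<Rightarrow> nat set"
    assume j: "j < D" and r: "r \<in> G j" and s: "s \<in> G j" and G: "\<forall>i. G i \<subseteq> {..<T}"
      and card: "\<forall>i<D. i \<noteq> j \<longrightarrow> R t \<le> card (G i)"
    have tG: "t \<le> card (G i)" if "i < D" "i \<noteq> j" for i
      by (rule order_trans[OF R(2)]) (use card that in simp)
    show "\<exists>H. H j = G j \<and> (\<forall>i. H i \<subseteq> G i) \<and> (\<forall>i<D. i \<noteq> j \<longrightarrow> t \<le> card (H i)) \<and> S j r s H"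
    proof (cases "r = s")
      case True
      then show ?thesis using tG by (intro exI[of _ G]) (simp add: S_def)
    next
      case rs: False
      define K where "K = {..<D} - {j}"
      \<comment> \<open>Restriction makes the grid a member of the finite set of extensional grids
        over which \<open>avoid\<close> ranges.\<close>
      define G' where "G' = restrict G K"
      define q where "q x = pt (x(j := s))" for x
      \<comment> \<open>If \<open>D = 1\<close> then \<open>K\<close> is empty, and \<open>t\<close> is not bounded by the grid size.\<close>
      define t' where "t' = min t T"
      have t': "t' = t" if "i \<in> K" for i
      proof -
        have "t \<le> card (G i)" using tG that by (simp add: K_def)
        also have "\<dots> \<le> card {..<T}" using G by (intro card_mono) auto
        finally show ?thesis by (simp add: t'_def)
      qed
      have rT: "r < T" and sT: "s < T" using r s G by auto
      have q: "q ` PiE K G' \<subseteq> X"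
      proof
        fix y assume "y \<in> q ` PiE K G'"
        then obtain x where x: "x \<in> PiE K G'" "y = pt (x(j := s))" unfolding q_def by blast
        have "PiE K G' \<subseteq> PiE K (\<lambda>_. {..<T})" using G by (intro PiE_mono) (auto simp: G'_def)
        then have "x(j := s) \<in> PiE (insert j K) (\<lambda>_. {..<T})" using x(1) sT by (intro PiE_fun_upd) auto
        moreover have "insert j K = {..<D}" using j by (auto simp: K_def)
        ultimately show "y \<in> X" using ptX x(2) by simp
      qed
      define z where "z = (SOME z. centre X C q G' K t' z)"
      have "\<exists>z. centre X C q G' K t' z"
      proof (rule centre_exists)
        show "grid_ramsey K h t' (R t')" unfolding K_def by (rule R(1)[OF j])
        show "R t' \<le> card (G' i)" if "i \<in> K" for i
          using card t'[OF that] that by (auto simp: G'_def K_def)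
        show "finite (G' i)" if "i \<in> K" for i
          using G that by (metis G'_def finite_lessThan finite_subset restrict_apply')
      qed (use q in \<open>auto simp: K_def\<close>)
      then have z: "centre X C q G' K t' z" unfolding z_def by (rule someI_ex)
      have "G' \<in> PiE K (\<lambda>_. Pow {..<T})" using G by (auto simp: G'_def)
      then have "z \<notin> A j r"
        using avoid[OF j rT sT rs, of t' G'] unfolding z_def q_def K_def t'_def by simp
      from halfspace_avoids_grid[OF sep A[OF j rT] z this]
      obtain \<gamma> where \<gamma>: "\<gamma> \<in> halfspaces X C" "A j r \<subseteq> \<gamma>" "grid_in G' K t' {x \<in> PiE K G'. q x \<notin> \<gamma>}"
        by blast
      then obtain H0 where H0: "\<forall>i\<in>K. H0 i \<subseteq> G' i \<and> t' \<le> card (H0 i)"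
        "PiE K H0 \<subseteq> {x \<in> PiE K G'. q x \<notin> \<gamma>}"
        unfolding grid_in_def by blast
      define H where "H i = (if i \<in> K then H0 i else G i)" for i
      have "pt x \<notin> \<gamma>" if x: "x \<in> PiE {..<D} H" "x j = s" for x
      proof -
        have "x \<in> PiE (insert j K) H" using x(1) j by (simp add: K_def insert_absorb)
        then have "x(j := undefined) \<in> PiE K H" by (intro fun_upd_in_PiE) (simp_all add: K_def)
        also have "PiE K H = PiE K H0" by (intro PiE_cong) (simp add: H_def)
        finally have "q (x(j := undefined)) \<notin> \<gamma>" using H0(2) by blast
        moreover have "x(j := s) = x" using x(2) by auto
        ultimately show ?thesis by (simp add: q_def)
      qed
      then have "S j r s H" unfolding S_def using \<gamma>(1,2) by blast
      moreover have "H j = G j" by (simp add: H_def K_def)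
      moreover have "H i \<subseteq> G i" for i using H0(1) by (auto simp: H_def G'_def)
      moreover have "t \<le> card (H i)" if "i < D" "i \<noteq> j" for i
      proof -
        have "i \<in> K" using that by (simp add: K_def)
        then show ?thesis using H0(1) t' by (auto simp: H_def)
      qed
      ultimately show ?thesis by (intro exI[of _ H]) simp
    qed
  qed
  \<comment> \<open>\<open>T\<close> is the side from which refining all \<open>D\<close> classes
    still leaves the two members per class needed for a Venn diagram.\<close>
  from grid_refine[OF this order_refl, of "\<lambda>_. {..<T}" 2]
  obtain H where H: "\<forall>i. H i \<subseteq> {..<T}" "\<forall>i<D. 2 \<le> card (H i)"
    "\<forall>j<D. \<forall>r\<in>H j. \<forall>s\<in>H j. S j r s H"
    using T by auto
  have sub: "PiE {..<D} H \<subseteq> PiE {..<D} (\<lambda>_. {..<T})" using H(1) by (intro PiE_mono) simp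
  show ?thesis
  proof (rule complete_venn_of_grid)
    show "pt x \<in> A j (x j)" if "x \<in> PiE {..<D} H" "j < D" for x j
      using pt sub that by blast
    show "pt x \<in> X" if "x \<in> PiE {..<D} H" for x using ptX sub that by blast
    show "\<exists>\<gamma>\<in>halfspaces X C. A j r \<subseteq> \<gamma> \<and> (\<forall>x\<in>PiE {..<D} H. x j = s \<longrightarrow> pt x \<notin> \<gamma>)"
      if "j < D" "r \<in> H j" "s \<in> H j" "r \<noteq> s" for j r s
      using H(3) that unfolding S_def by simp
  qed (use H in auto)
qed

text \<open>Fix every entry of the sample but the \<open>r\<close>-th of class \<open>j\<close>. The
  point \<open>g f\<close> is then fixed too, and the free entry contains it for at most
  \<open>\<beta> * card F\<close> choices. The two nested counts run over that entry and over class
  \<open>j\<close>.\<close>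

lemma card_independent_incidences:
  fixes F :: "'a set set" and g :: "(nat \<Rightarrow> nat \<Rightarrow> 'a set) \<Rightarrow> 'a"
  assumes F: "finite F" and j: "j < D" and r: "r < T"
    and depth: "\<And>z. real (card {A \<in> F. z \<in> A}) \<le> \<beta> * real (card F)"
    and g: "\<And>f a. g (f(j := (f j)(r := a))) = g f"
  shows "real (card {f \<in> PiE {..<D} (\<lambda>_. PiE {..<T} (\<lambda>_. F)). g f \<in> f j r})
      \<le> \<beta> * real (card F) ^ (D * T)"
proof -
  define n where "n = real (card F)"
  define W where "W = PiE {..<T} (\<lambda>_. F)"
  have W: "finite W" "real (card W) = n ^ T" using F by (auto simp: W_def n_def finite_PiE card_PiE)
  have inner: "real (card {w \<in> W. g (f(j := w)) \<in> (f(j := w)) j r}) \<le> \<beta> * n * n ^ (T - 1)" for f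
  proof -
    have "real (card {w \<in> PiE {..<T} (\<lambda>_. F). g (f(j := w)) \<in> (f(j := w)) j r})
        \<le> (\<beta> * n) * real (card F) ^ (card {..<T} - 1)"
    proof (rule card_PiE_Collect_le)
      fix w
      have "g (f(j := w(r := a))) = g (f(j := w))" for a
        using g[of "f(j := w)" a] by simp
      then show "real (card {a \<in> F. g (f(j := w(r := a))) \<in> (f(j := w(r := a))) j r}) \<le> \<beta> * n"
        using depth by (simp add: n_def)
    qed (use F r in auto)
    then show ?thesis by (simp add: W_def n_def)
  qed
  have "real (card {f \<in> PiE {..<D} (\<lambda>_. W). g f \<in> f j r})
      \<le> \<beta> * n * n ^ (T - 1) * real (card W) ^ (card {..<D} - 1)"
    by (rule card_PiE_Collect_le) (use W j inner in auto)
  also have "\<dots> = \<beta> * (n * n ^ (T - 1) * (n ^ T) ^ (D - 1))" by (simp add: W)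
  also have "n * n ^ (T - 1) = n ^ T" using r by (cases T) auto
  also have "n ^ T * (n ^ T) ^ (D - 1) = n ^ (D * T)"
    using j by (cases D) (auto simp: power_mult[symmetric] power_add mult.commute)
  finally show ?thesis by (simp add: W_def n_def)
qed

text \<open>Every such set is the range of some tuple; only a lower bound on the tuples is wanted,
  so the several orderings of a set do no harm.\<close>

lemma card_intersecting_le_tuples:
  assumes "finite F"
  shows "card {S. S \<subseteq> F \<and> card S = k \<and> intersecting S}
    \<le> card {g \<in> PiE {..<k} (\<lambda>_. F). (\<Inter>j<k. g j) \<noteq> {}}"
proof (rule surj_card_le[where f = "\<lambda>g. g ` {..<k}"])
  have "finite (PiE {..<k} (\<lambda>_. F))" using assms by (auto intro: finite_PiE)
  then show "finite {g \<in> PiE {..<k} (\<lambda>_. F). (\<Inter>j<k. g j) \<noteq> {}}" by simp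
  show "{S. S \<subseteq> F \<and> card S = k \<and> intersecting S}
      \<subseteq> (\<lambda>g. g ` {..<k}) ` {g \<in> PiE {..<k} (\<lambda>_. F). (\<Inter>j<k. g j) \<noteq> {}}"
  proof
    fix S assume "S \<in> {S. S \<subseteq> F \<and> card S = k \<and> intersecting S}"
    then have S: "S \<subseteq> F" "card S = k" "\<Inter>S \<noteq> {}" by (auto simp: intersecting_def)
    then have "finite S" using assms finite_subset by blast
    then obtain e where "bij_betw e {0..<card S} S" using ex_bij_betw_nat_finite by blast
    then have e: "e ` {..<k} = S" using S(2) by (auto simp: bij_betw_def atLeast0LessThan)
    have img: "restrict e {..<k} ` {..<k} = S" using e by (simp add: image_restrict_eq)
    have "restrict e {..<k} \<in> PiE {..<k} (\<lambda>_. F)" using e S(1) by auto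
    moreover have "(\<Inter>j<k. restrict e {..<k} j) \<noteq> {}" using S(3) img by simp
    ultimately show "S \<in> (\<lambda>g. g ` {..<k}) ` {g \<in> PiE {..<k} (\<lambda>_. F). (\<Inter>j<k. g j) \<noteq> {}}"
      using img by (intro image_eqI[of _ _ "restrict e {..<k}"]) auto
  qed
qed

text \<open>The probabilistic half. Without a deep point the bad incidences together are rarer than
  the samples with all rainbow tuples intersecting, so some such sample avoids them all and yields a
  forbidden Venn diagram.\<close>

lemma (in radon_space) deep_point:
  assumes sep: "separable X C" and D: "D > 0"
    and venn: "\<not> has_complete_venn X (halfspaces X C) D" and \<epsilon>: "\<epsilon> > 0"
  shows "\<exists>\<beta>>0. \<beta> < 1 \<and> (\<forall>F. finite F \<and> F \<noteq> {} \<and> F \<subseteq> C \<and>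
      real (card {g \<in> PiE {..<D} (\<lambda>_. F). (\<Inter>j<D. g j) \<noteq> {}}) \<ge> \<epsilon> * real (card F) ^ D \<longrightarrow>
      (\<exists>z. real (card {A \<in> F. z \<in> A}) \<ge> \<beta> * real (card F)))"
proof -
  have "\<forall>j t. \<exists>R. grid_ramsey ({..<D} - {j}) h t R" by (simp add: grid_ramsey_exists)
  then obtain R0 where R0: "\<And>j t. grid_ramsey ({..<D} - {j}) h t (R0 j t)" by metis
  \<comment> \<open>The sum serves all classes \<open>j\<close> at once; the summand
    \<open>t\<close> ensures \<open>t \<le> R t\<close>.\<close>
  define R where "R t = t + (\<Sum>j<D. R0 j t)" for t
  have R: "grid_ramsey ({..<D} - {j}) h t (R t)" if "j < D" for j t
  proof (rule grid_ramsey_mono[OF R0])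
    have "R0 j t \<le> (\<Sum>j<D. R0 j t)" using that by (intro member_le_sum) auto
    then show "R0 j t \<le> R t" by (simp add: R_def)
  qed
  define T where "T = ((\<lambda>t. max t ((R ^^ (t * t)) t)) ^^ D) 2"
  define Gs where "Gs = (\<Union>j<D. PiE ({..<D} - {j}) (\<lambda>_. Pow {..<T}))"
  \<comment> \<open>All parameters of a possible bad incidence. Their number does not depend on
    \<open>F\<close>, hence neither does \<open>\<beta>\<close>.\<close>
  define Idx where "Idx = {..<D} \<times> {..<T} \<times> {..<T} \<times> {..T} \<times> Gs"
  have "finite Gs" unfolding Gs_def by (intro finite_UN_I finite_PiE) auto
  then have Idx: "finite Idx" unfolding Idx_def by auto
  obtain \<delta> where \<delta>: "\<delta> > 0" and super: "\<forall>(V::'a set set) E. finite V \<longrightarrow> V \<noteq> {} \<longrightarrow>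
    (\<forall>f g. (\<forall>j<D. f j = g j) \<longrightarrow> E f = E g) \<longrightarrow>
    real (card {g \<in> PiE {..<D} (\<lambda>_. V). E g}) \<ge> \<epsilon> * real (card V) ^ D \<longrightarrow>
    real (card {f \<in> PiE {..<D} (\<lambda>_. PiE {..<T} (\<lambda>_. V)).
        \<forall>x\<in>PiE {..<D} (\<lambda>_. {..<T}). E (\<lambda>j. f j (x j))}) \<ge> \<delta> * real (card V) ^ (D * T)"
    using complete_multipartite_supersaturation[OF \<epsilon>, of D T] by (elim exE conjE)
  \<comment> \<open>Small enough for the union bound \<open>card Idx * \<beta> < \<delta>\<close>;
    adding 1 avoids a division by zero.\<close>
  define \<beta> where "\<beta> = min (1 / 2) (\<delta> / (2 * (real (card Idx) + 1)))"
  have \<beta>: "0 < \<beta>" "\<beta> < 1" using \<delta> by (auto simp: \<beta>_def)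
  have "real (card Idx) * \<beta> \<le> real (card Idx) * (\<delta> / (2 * (real (card Idx) + 1)))"
    unfolding \<beta>_def by (intro mult_left_mono) auto
  also have "\<dots> < \<delta>" using \<delta> by (simp add: field_simps add_nonneg_pos)
  finally have Idx\<beta>: "real (card Idx) * \<beta> < \<delta>" .
  show ?thesis
  proof (intro exI[of _ \<beta>] conjI \<beta> allI impI, rule ccontr)
    fix F
    assume F: "finite F \<and> F \<noteq> {} \<and> F \<subseteq> C \<and>
      real (card {g \<in> PiE {..<D} (\<lambda>_. F). (\<Inter>j<D. g j) \<noteq> {}}) \<ge> \<epsilon> * real (card F) ^ D"
    assume "\<nexists>z. real (card {A \<in> F. z \<in> A}) \<ge> \<beta> * real (card F)"
    then have depth: "real (card {A \<in> F. z \<in> A}) \<le> \<beta> * real (card F)" for z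
      by (meson linorder_not_le less_imp_le)
    define n where "n = real (card F)"
    have n: "n > 0" using F by (simp add: n_def card_gt_0_iff)
    define P where "P = PiE {..<D} (\<lambda>_. PiE {..<T} (\<lambda>_. F))"
    have P: "finite P" using F by (auto simp: P_def intro!: finite_PiE)
    define \<Phi> where "\<Phi> = {f \<in> P. \<forall>x\<in>PiE {..<D} (\<lambda>_. {..<T}). (\<Inter>j<D. f j (x j)) \<noteq> {}}"
    have \<Phi>: "real (card \<Phi>) \<ge> \<delta> * n ^ (D * T)" unfolding \<Phi>_def P_def n_def
      by (rule super[rule_format, of F "\<lambda>g. (\<Inter>j<D. g j) \<noteq> {}"]) (use F in auto)
    define pt where "pt f x = (SOME y. y \<in> (\<Inter>j<D. f j (x j)))" for f :: "nat \<Rightarrow> nat \<Rightarrow> 'a set" and x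
    define cz where "cz j s t G f = (SOME z. centre X C (\<lambda>x. pt f (x(j := s))) G ({..<D} - {j}) t z)"
      for j s t G f
    define bad where "bad = (\<lambda>(j, r, s, t, G). {f \<in> P. r \<noteq> s \<and> cz j s t G f \<in> f j r})"
    have bad: "real (card (bad i)) \<le> \<beta> * n ^ (D * T)" if i: "i \<in> Idx" for i
    proof -
      obtain j r s t G where ieq: "i = (j, r, s, t, G)" by (cases i)
      show ?thesis
      proof (cases "r = s")
        case True
        then show ?thesis using \<beta> n by (simp add: bad_def ieq)
      next
        case False
        have "cz j s t G (f(j := (f j)(r := a))) = cz j s t G f" for f a
        proof -
          \<comment> \<open>The chosen point depends only on the intersection of the tuple, and a
            tuple with \<open>j\<close>-th coordinate \<open>s \<noteq> r\<close> does not involve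
            the changed entry.\<close>
          have "pt (f(j := (f j)(r := a))) (x(j := s)) = pt f (x(j := s))" for x
          proof -
            have "(\<Inter>i<D. (f(j := (f j)(r := a))) i ((x(j := s)) i)) = (\<Inter>i<D. f i ((x(j := s)) i))"
              using False by (intro INF_cong) auto
            then show ?thesis by (simp only: pt_def)
          qed
          then show ?thesis by (simp only: cz_def)
        qed
        then have "real (card {f \<in> P. cz j s t G f \<in> f j r}) \<le> \<beta> * n ^ (D * T)"
          using i F depth unfolding P_def n_def ieq Idx_def
          by (intro card_independent_incidences) auto
        then show ?thesis using False by (simp add: bad_def ieq)
      qed
    qed
    have "\<not> \<Phi> \<subseteq> (\<Union>i\<in>Idx. bad i)"
    proof
      assume sub: "\<Phi> \<subseteq> (\<Union>i\<in>Idx. bad i)"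
      have "bad i \<subseteq> P" for i by (auto simp: bad_def split: prod.splits)
      then have "finite (\<Union>i\<in>Idx. bad i)" using P Idx by (meson finite_UN_I finite_subset)
      then have "real (card \<Phi>) \<le> real (card (\<Union>i\<in>Idx. bad i))" using sub by (intro of_nat_mono card_mono)
      also have "\<dots> \<le> (\<Sum>i\<in>Idx. real (card (bad i)))"
        using card_UN_le[OF Idx, of bad] by (metis of_nat_le_iff of_nat_sum)
      also have "\<dots> \<le> (\<Sum>i\<in>Idx. \<beta> * n ^ (D * T))" by (intro sum_mono bad)
      also have "\<dots> = real (card Idx) * \<beta> * n ^ (D * T)" by simp
      also have "\<dots> < \<delta> * n ^ (D * T)" using Idx\<beta> n by (intro mult_strict_right_mono) auto
      finally show False using \<Phi> by simp
    qed
    then obtain f where f: "f \<in> \<Phi>" "\<And>i. i \<in> Idx \<Longrightarrow> f \<notin> bad i" by blast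
    have fF: "f j i \<in> F" if "j < D" "i < T" for j i
      using f(1) that unfolding \<Phi>_def P_def by (auto simp: PiE_iff)
    have "has_complete_venn X (halfspaces X C) D"
    proof (rule complete_venn_of_avoided_centres[OF sep D R _ T_def, of f "pt f"])
      show "t \<le> R t" for t by (simp add: R_def)
      show "f j i \<in> C" if "j < D" "i < T" for j i using fF[OF that] F by blast
      show "pt f x \<in> f j (x j)" if x: "x \<in> PiE {..<D} (\<lambda>_. {..<T})" and j: "j < D" for x j
      proof -
        have "(\<Inter>j<D. f j (x j)) \<noteq> {}" using f(1) x unfolding \<Phi>_def by simp
        then have "pt f x \<in> (\<Inter>j<D. f j (x j))" unfolding pt_def by (rule some_in_eq[THEN iffD2])
        then show ?thesis using j by simp
      qed
      show "(SOME z. centre X C (\<lambda>x. pt f (x(j := s))) G ({..<D} - {j}) t z) \<notin> f j r"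
        if "j < D" "r < T" "s < T" "r \<noteq> s" "t \<le> T" "G \<in> PiE ({..<D} - {j}) (\<lambda>_. Pow {..<T})"
        for j r s t G
      proof -
        have "G \<in> Gs" unfolding Gs_def using that by (intro UN_I[of j]) auto
        then have "f \<notin> bad (j, r, s, t, G)" using that by (intro f(2)) (auto simp: Idx_def)
        moreover have "f \<in> P" using f(1) by (simp add: \<Phi>_def)
        ultimately show ?thesis using that(4) by (simp add: bad_def cz_def)
      qed
    qed
    then show False using venn by contradiction
  qed
qed

theorem theorem1p5:
  fixes X :: "'a set" and C :: "'a set set" and d :: nat
  assumes "convexity_space X C"
    and "separable X C"
    and "bounded_radon_number X C"
    and "dual_vc_dim X (halfspaces X C) d"
  shows "fractional_helly C (d + 1)"
proof -
  obtain h where "\<forall>Y. Y \<subseteq> X \<and> finite Y \<and> card Y = h \<longrightarrow>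
      (\<exists>A B. Y = A \<union> B \<and> A \<inter> B = {} \<and> conv C A \<inter> conv C B \<noteq> {})"
    using assms(3) unfolding bounded_radon_number_def by (elim exE)
  then interpret radon_space X C h using assms(1) by unfold_locales auto
  define D where "D = d + 1"
  have D: "D > 0" by (simp add: D_def)
  have venn: "\<not> has_complete_venn X (halfspaces X C) D"
  proof
    assume "has_complete_venn X (halfspaces X C) D"
    then have "D \<le> d" using assms(4)[unfolded dual_vc_dim_def] by simp
    then show False by (simp add: D_def)
  qed
  define deep where "deep \<alpha> \<beta> \<longleftrightarrow> 0 < \<beta> \<and> \<beta> < 1 \<and> (\<forall>F. finite F \<and> F \<noteq> {} \<and> F \<subseteq> C \<and>
      real (card {g \<in> PiE {..<D} (\<lambda>_. F). (\<Inter>j<D. g j) \<noteq> {}}) \<ge> \<alpha> / real D ^ D * real (card F) ^ D \<longrightarrow>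
      (\<exists>z. real (card {A \<in> F. z \<in> A}) \<ge> \<beta> * real (card F)))" for \<alpha> \<beta> :: real
  have "\<exists>\<beta>. deep \<alpha> \<beta>" if "\<alpha> > 0" for \<alpha>
    unfolding deep_def by (rule deep_point[OF assms(2) D venn]) (use D that in simp)
  then obtain \<beta> where \<beta>: "\<And>\<alpha>. \<alpha> > 0 \<Longrightarrow> deep \<alpha> (\<beta> \<alpha>)" by metis
  have "\<exists>G\<subseteq>F. intersecting G \<and> real (card G) \<ge> \<beta> \<alpha> * real (card F)"
    if \<alpha>: "0 < \<alpha>" and F: "finite F" "F \<subseteq> C" "D \<le> card F"
      and many: "real (card {T. T \<subseteq> F \<and> card T = D \<and> intersecting T}) \<ge> \<alpha> * real (card F choose D)"
    for \<alpha> F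
  proof -
    \<comment> \<open>The factor \<open>1 / D ^ D\<close> comes from bounding the binomial
      coefficient below by \<open>(card F / D) ^ D\<close>.\<close>
    have "\<alpha> / real D ^ D * real (card F) ^ D = \<alpha> * (real (card F) / real D) ^ D"
      by (simp add: power_divide)
    also have "\<dots> \<le> \<alpha> * real (card F choose D)"
      using binomial_ge_n_over_k_pow_k[OF F(3), where 'a = real] \<alpha> by (intro mult_left_mono) auto
    also have "\<dots> \<le> real (card {g \<in> PiE {..<D} (\<lambda>_. F). (\<Inter>j<D. g j) \<noteq> {}})"
      using many card_intersecting_le_tuples[OF F(1), of D] by linarith
    finally have dens: "\<alpha> / real D ^ D * real (card F) ^ D \<le>
      real (card {g \<in> PiE {..<D} (\<lambda>_. F). (\<Inter>j<D. g j) \<noteq> {}})" .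
    have "F \<noteq> {}" using F(3) D by auto
    then obtain z where "real (card {A \<in> F. z \<in> A}) \<ge> \<beta> \<alpha> * real (card F)"
      using \<beta>[OF \<alpha>] F dens unfolding deep_def by blast
    moreover have "intersecting {A \<in> F. z \<in> A}" unfolding intersecting_def by blast
    ultimately show ?thesis by (intro exI[of _ "{A \<in> F. z \<in> A}"]) auto
  qed
  moreover have "0 < \<beta> \<alpha> \<and> \<beta> \<alpha> < 1" if "0 < \<alpha>" for \<alpha>
    using \<beta>[OF that] unfolding deep_def by blast
  ultimately show ?thesis
    unfolding fractional_helly_def D_def[symmetric] by (intro exI[of _ \<beta>]) simp
qed

end
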